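(* Suppose that $\mathcal H$ has finite dimension, and that the gradients $\nabla f_i : \mathcal H \to \mathcal H$, $i\in\{1,\dots,q\}$, are globally Lipschitz continuous. Then, for all $t_0 \in \mathbb R$ and all $(u_0,\dot u_0) \in \mathcal H \times \mathcal H$, there exists a function $u : [t_0,+\infty[ \to \mathcal H$ of class $C^2$ such that $$ m \ddot u(t) = -\gamma \dot u(t) + s(u(t)) \ \text{ for all } t\in [t_0,+\infty[, \quad \text{with } u(t_0)=u_0,\ \dot u(t_0)=\dot u_0.$$
   Context: $\mathcal H$ is a real Hilbert space, $q\ge 1$ is an integer, and $f_i : \mathcal H \to \mathbb R$ ($i\in\{1,\dots,q\}$) are continuously differentiable functions whose gradients $\nabla f_i$ are Lipschitz continuous on bounded sets. $m>0$ and $\gamma>0$ are fixed real parameters. For $u\in\mathcal H$, let $\mathrm{co}\,\nabla f_i(u)$ denote the convex hull of $\{\nabla f_1(u),\dots,\nabla f_q(u)\}$ (a convex compact set). The multi-objective steepest descent vector field $s:\mathcal H\to\mathcal H$ is defined by letting $-s(u)$ be the element of minimal norm of $\mathrm{co}\,\nabla f_i(u)$. Derivatives at the left endpoint $t_0$ are right derivatives. *)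

theory Defs
  imports "HOL-Analysis.Analysis"
begin

definition continuously_differentiable :: "('a::real_normed_vector \<Rightarrow> 'b::real_normed_vector) \<Rightarrow> bool" where
  "continuously_differentiable f \<longleftrightarrow>
     (\<exists>f' :: 'a \<Rightarrow> 'a \<Rightarrow>\<^sub>L 'b. (\<forall>u. (f has_derivative blinfun_apply (f' u)) (at u)) \<and> continuous_on UNIV f')"

(* Meaningful only where f is Frechet differentiable with a Riesz representative; in a Hilbert
   space differentiability suffices. *)
definition gradient :: "('a::real_inner \<Rightarrow> real) \<Rightarrow> 'a \<Rightarrow> 'a" where
  "gradient f u = (THE g. GDERIV f u :> g)"

definition grad_hull :: "nat \<Rightarrow> (nat \<Rightarrow> 'a::real_inner \<Rightarrow> real) \<Rightarrow> 'a \<Rightarrow> 'a set" where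
  "grad_hull q f u = convex hull ((\<lambda>i. gradient (f i) u) ` {1..q})"

(* The minimiser is unique because grad_hull q f u is convex; it exists when q \<ge> 1 because
   the hull is then nonempty and compact. *)
definition steepest_descent :: "nat \<Rightarrow> (nat \<Rightarrow> 'a::real_inner \<Rightarrow> real) \<Rightarrow> 'a \<Rightarrow> 'a" where
  "steepest_descent q f u = - arg_min norm (\<lambda>x. x \<in> grad_hull q f u)"

end

theory Submission
  imports Defs "HOL-Complex_Analysis.Great_Picard"
begin

text \<open>
  Written as a first order system for the pair of position and velocity, the equation reads
  \<open>z' = F z\<close> with \<open>F (u, v) = (v, (s u - \<gamma> v) / m)\<close>. The steepest descent field \<open>s\<close> need not be
  Lipschitz (the minimal norm element of a convex set moves in general only like the square root
  of the displacement of the set), so a contraction argument is not available. But \<open>s\<close> is continuous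
  (\<open>continuous_on_steepest_descent\<close>), and it grows at most linearly, since its norm is bounded
  by that of any single gradient and the gradients are globally Lipschitz. In finite dimension,
  a global form of Peano's theorem for continuous fields of linear growth
  (\<open>peano_linear_growth\<close>) then gives a solution on the whole half line.

  Peano's theorem is proved with explicit Euler schemes of step size tending to \<open>0\<close>, seen as step
  functions of time. Linear growth bounds them by an exponential that does not depend on the step
  size, hence they are Lipschitz on bounded time intervals, uniformly up to an error of one step.
  Boundedness gives a subsequence that converges at all rational times, and
  the uniform Lipschitz bound extends the convergence to all times. To see that the limit solves the
  equation, no integral is needed: near a time \<open>s\<close> all increments of the schemes lie within
  \<open>e\<close> times the elapsed time of the increments with constant slope \<open>F (x s)\<close>, and this
  estimate passes to pointwise limits and is exactly differentiability at \<open>s\<close>.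
\<close>

section \<open>Continuity of the steepest descent field\<close>

text \<open>
  The closed \<open>d\<close>-neighbourhood of a convex set is convex, as a Minkowski sum with a ball; so it
  contains a convex hull as soon as it contains the generators.
\<close>
lemma convex_hull_image_perturbation:
  fixes a b :: "'i \<Rightarrow> 'a::real_normed_vector"
  assumes close: "\<And>i. i \<in> I \<Longrightarrow> dist (a i) (b i) \<le> d"
    and z: "z \<in> convex hull (a ` I)"
  shows "\<exists>w \<in> convex hull (b ` I). dist z w \<le> d"
proof -
  let ?N = "\<Union>x \<in> convex hull (b ` I). \<Union>y \<in> cball 0 d. {x + y}"
  have "a ` I \<subseteq> ?N"
  proof
    fix x assume "x \<in> a ` I"
    then obtain i where i: "i \<in> I" "x = a i" by auto
    have "b i \<in> convex hull (b ` I)" using i by (simp add: hull_inc)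
    moreover have "a i - b i \<in> cball 0 d"
      using close[OF i(1)] by (simp add: dist_norm norm_minus_commute)
    ultimately show "x \<in> ?N" using i(2) by force
  qed
  moreover have "convex ?N"
    by (intro convex_sums) auto
  ultimately have "convex hull (a ` I) \<subseteq> ?N"
    by (rule hull_minimal)
  with z obtain x y where "x \<in> convex hull (b ` I)" "y \<in> cball 0 d" "z = x + y"
    by auto
  then show ?thesis by (intro bexI[of _ x]) (auto simp: dist_norm)
qed

text \<open>
  The minimal norm element \<open>p\<close> of a convex set \<open>S\<close> satisfies \<open>p \<bullet> p \<le> p \<bullet> w\<close> for all \<open>w \<in> S\<close>.
  Applied to a point \<open>w\<close> of \<open>S\<close> near \<open>r\<close>, this almost bounds \<open>p \<bullet> p\<close> by \<open>p \<bullet> r\<close>; adding the symmetric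
  inequality yields \<open>p \<bullet> p - 2 * (p \<bullet> r) + r \<bullet> r\<close> on the left. The square is what makes the
  dependence on the set merely Hoelder continuous with exponent one half.
\<close>
lemma min_norm_elements_close:
  fixes S T :: "'a::real_inner set"
  assumes S: "convex S" "closed S" "p \<in> S" "\<And>z. z \<in> S \<Longrightarrow> norm p \<le> norm z"
    and T: "convex T" "closed T" "r \<in> T" "\<And>z. z \<in> T \<Longrightarrow> norm r \<le> norm z"
    and pT: "\<exists>w\<in>T. dist p w \<le> d" and rS: "\<exists>w\<in>S. dist r w \<le> d"
  shows "(norm (p - r))\<^sup>2 \<le> d * (norm p + norm r)"
proof -
  have half: "p \<bullet> p - p \<bullet> r \<le> d * norm p"
    if min: "convex S" "closed S" "p \<in> S" "\<And>z. z \<in> S \<Longrightarrow> norm p \<le> norm z"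
      and near: "\<exists>w\<in>S. dist r w \<le> d"
    for S and p r :: 'a
  proof -
    obtain w where w: "w \<in> S" "dist r w \<le> d" using near by blast
    have "inner (0 - p) (w - p) \<le> 0"
      by (rule any_closest_point_dot[of S]) (use min w in auto)
    then have "p \<bullet> p - p \<bullet> r \<le> p \<bullet> (w - r)"
      by (simp add: inner_diff_left inner_diff_right)
    also have "\<dots> \<le> norm p * norm (w - r)"
      by (rule norm_cauchy_schwarz)
    also have "\<dots> \<le> norm p * d"
      using w(2) by (intro mult_left_mono) (auto simp: dist_norm norm_minus_commute)
    finally show ?thesis by (simp add: mult.commute)
  qed
  have "(norm (p - r))\<^sup>2 = (p \<bullet> p - p \<bullet> r) + (r \<bullet> r - r \<bullet> p)"
    by (simp add: power2_norm_eq_inner inner_diff_left inner_diff_right inner_commute)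
  also have "\<dots> \<le> d * norm p + d * norm r"
    by (intro add_mono half[of S] half[of T]) (use assms in auto)
  finally show ?thesis by (simp add: distrib_left)
qed

text \<open>
  The minimum in the definition is attained because the hull of finitely many points is compact;
  without this, the choice of a minimiser would say nothing.
\<close>
lemma minus_steepest_descent_min_norm:
  fixes f :: "nat \<Rightarrow> 'a::real_inner \<Rightarrow> real"
  assumes "q \<ge> 1"
  shows "- steepest_descent q f u \<in> grad_hull q f u"
    and "z \<in> grad_hull q f u \<Longrightarrow> norm (steepest_descent q f u) \<le> norm z"
proof -
  have "compact (grad_hull q f u)"
    unfolding grad_hull_def by (intro finite_imp_compact_convex_hull) auto
  moreover have "grad_hull q f u \<noteq> {}"
    using assms by (auto simp: grad_hull_def)
  ultimately obtain p where p: "p \<in> grad_hull q f u" "\<And>z. z \<in> grad_hull q f u \<Longrightarrow> norm p \<le> norm z"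
    using continuous_attains_inf[of "grad_hull q f u" norm] continuous_on_norm_id by blast
  have "arg_min norm (\<lambda>x. x \<in> grad_hull q f u) \<in> grad_hull q f u \<and>
    (\<forall>z\<in>grad_hull q f u. norm (arg_min norm (\<lambda>x. x \<in> grad_hull q f u)) \<le> norm z)"
    by (rule arg_minI[where x = p and f = norm and P = "\<lambda>x. x \<in> grad_hull q f u"
          and Q = "\<lambda>a. a \<in> grad_hull q f u \<and> (\<forall>z\<in>grad_hull q f u. norm a \<le> norm z)"])
       (use p in \<open>auto simp: not_less\<close>)
  then show "- steepest_descent q f u \<in> grad_hull q f u"
    and "z \<in> grad_hull q f u \<Longrightarrow> norm (steepest_descent q f u) \<le> norm z"
    by (auto simp: steepest_descent_def)
qed

lemma gradient_in_grad_hull: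
  "i \<in> {1..q} \<Longrightarrow> gradient (f i) u \<in> grad_hull q f u"
  by (simp add: grad_hull_def hull_inc)

text \<open>
  The hulls at \<open>v\<close> and \<open>u\<close> are as close as their generators, and the norms of the minimal elements
  are controlled by the first gradient, so the right hand side mentions gradients only and is
  visibly continuous.
\<close>
lemma steepest_descent_dist_bound:
  fixes f :: "nat \<Rightarrow> 'a::real_inner \<Rightarrow> real"
  assumes q: "q \<ge> 1"
  shows "(norm (steepest_descent q f v - steepest_descent q f u))\<^sup>2
     \<le> (\<Sum>i\<in>{1..q}. dist (gradient (f i) v) (gradient (f i) u))
        * (norm (gradient (f 1) v) + norm (gradient (f 1) u))"
proof -
  let ?s = "steepest_descent q f"
  let ?d = "\<Sum>i\<in>{1..q}. dist (gradient (f i) v) (gradient (f i) u)"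
  have conv: "convex (grad_hull q f w)" and clos: "closed (grad_hull q f w)" for w
    unfolding grad_hull_def
    by (auto intro!: compact_imp_closed finite_imp_compact_convex_hull)
  have d: "dist (gradient (f i) v) (gradient (f i) u) \<le> ?d" if "i \<in> {1..q}" for i
    by (rule member_le_sum) (use that in auto)
  have 1: "\<exists>w\<in>grad_hull q f u. dist (- ?s v) w \<le> ?d"
    using minus_steepest_descent_min_norm(1)[OF q, of f v] unfolding grad_hull_def
    by (rule convex_hull_image_perturbation[rotated]) (rule d)
  have 2: "\<exists>w\<in>grad_hull q f v. dist (- ?s u) w \<le> ?d"
    using minus_steepest_descent_min_norm(1)[OF q, of f u] unfolding grad_hull_def
    by (rule convex_hull_image_perturbation[rotated]) (use d in \<open>simp add: dist_commute\<close>)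
  have "(norm (- ?s v - (- ?s u)))\<^sup>2 \<le> ?d * (norm (- ?s v) + norm (- ?s u))"
    by (rule min_norm_elements_close[OF conv clos _ _ conv clos _ _ 1 2])
       (use minus_steepest_descent_min_norm[OF q] in auto)
  also have "\<dots> \<le> ?d * (norm (gradient (f 1) v) + norm (gradient (f 1) u))"
    using minus_steepest_descent_min_norm(2)[OF q gradient_in_grad_hull[of 1 q f]] q
    by (intro mult_left_mono add_mono sum_nonneg) auto
  finally show ?thesis
    by (simp add: norm_minus_commute)
qed

lemma continuous_on_steepest_descent:
  fixes f :: "nat \<Rightarrow> 'a::real_inner \<Rightarrow> real"
  assumes q: "q \<ge> 1"
    and cont: "\<And>i. i \<in> {1..q} \<Longrightarrow> continuous_on UNIV (gradient (f i))"
  shows "continuous_on UNIV (steepest_descent q f)"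
  unfolding continuous_on_def
proof
  fix u :: 'a
  let ?s = "steepest_descent q f"
  let ?b = "\<lambda>v. (\<Sum>i\<in>{1..q}. dist (gradient (f i) v) (gradient (f i) u))
        * (norm (gradient (f 1) v) + norm (gradient (f 1) u))"
  have g: "(gradient (f i) \<longlongrightarrow> gradient (f i) u) (at u)" if "i \<in> {1..q}" for i
    using cont[OF that] by (auto simp: continuous_on_def)
  have "(?b \<longlongrightarrow> (\<Sum>i\<in>{1..q}. dist (gradient (f i) u) (gradient (f i) u))
        * (norm (gradient (f 1) u) + norm (gradient (f 1) u))) (at u)"
    using q by (intro tendsto_intros g) auto
  then have b: "(?b \<longlongrightarrow> 0) (at u)" by simp
  have "((\<lambda>v. (norm (?s v - ?s u))\<^sup>2) \<longlongrightarrow> 0) (at u)"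
    by (rule tendsto_sandwich[OF _ _ tendsto_const b])
       (use steepest_descent_dist_bound[OF q, of f] in auto)
  then have "((\<lambda>v. sqrt ((norm (?s v - ?s u))\<^sup>2)) \<longlongrightarrow> sqrt 0) (at u)"
    by (rule tendsto_real_sqrt)
  then show "(?s \<longlongrightarrow> ?s u) (at u)"
    by (simp add: tendsto_norm_zero_iff LIM_zero_iff)
qed

section \<open>Pointwise convergent subsequences in finite dimension\<close>

text \<open>
  A zero vector in \<open>C\<close> is harmless: its coefficient is a division by zero, hence \<open>0\<close>.
\<close>
lemma orthogonal_expansion:
  fixes C :: "'a::real_inner set"
  assumes C: "finite C" "pairwise orthogonal C" "span C = UNIV"
  shows "x = (\<Sum>c\<in>C. (x \<bullet> c / (c \<bullet> c)) *\<^sub>R c)"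
proof -
  let ?y = "x - (\<Sum>c\<in>C. (x \<bullet> c / (c \<bullet> c)) *\<^sub>R c)"
  have "orthogonal ?y e" if e: "e \<in> C" for e
  proof -
    have "(\<Sum>c\<in>C. (x \<bullet> c / (c \<bullet> c)) *\<^sub>R c) \<bullet> e = (\<Sum>c\<in>C. if c = e then x \<bullet> e else 0)"
      unfolding inner_sum_left
      by (rule sum.cong) (use e C(2) in \<open>auto simp: pairwise_def orthogonal_def\<close>)
    then show ?thesis
      using e C(1) by (simp add: orthogonal_def inner_diff_left)
  qed
  then have "C \<subseteq> {z. orthogonal ?y z}" by auto
  moreover have "subspace {z. orthogonal ?y z}"
    by (auto simp: subspace_def orthogonal_clauses)
  ultimately have "span C \<subseteq> {z. orthogonal ?y z}"
    by (rule span_minimal)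
  then have "orthogonal ?y ?y"
    unfolding C(3) by auto
  then show ?thesis
    by (simp add: orthogonal_self)
qed

text \<open>
  The Cantor diagonal argument, with a bound that may vary from point to point. It is run on real
  sequences: the coordinates with respect to an orthogonal basis, indexed by pairs of a
  point and a basis vector and divided by their bound so that they lie in \<open>[-1, 1]\<close>. This
  is the only place where finite dimension enters.
\<close>
lemma pointwise_convergent_subsequence:
  fixes X :: "nat \<Rightarrow> 't \<Rightarrow> 'a::real_inner"
  assumes fin: "finite B" "span B = (UNIV :: 'a set)"
    and S: "countable S"
    and bound: "\<And>n t. t \<in> S \<Longrightarrow> norm (X n t) \<le> b t"
  obtains k :: "nat \<Rightarrow> nat" where "strict_mono k"
    "\<And>t. t \<in> S \<Longrightarrow> convergent (\<lambda>n. X (k n) t)"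
proof -
  obtain C where C: "finite C" "pairwise orthogonal C" "span C = (UNIV :: 'a set)"
    using basis_orthogonal[OF fin(1)] fin(2) by auto
  define f where "f = (\<lambda>n (t, c). (X n t \<bullet> c) / (b t * norm c))"
  have le: "\<bar>X n t \<bullet> c\<bar> \<le> b t * norm c" if "t \<in> S" for n t c
    using Cauchy_Schwarz_ineq2[of "X n t" c] bound[OF that, of n]
    by (meson mult_right_mono norm_ge_zero order_trans)
  have "norm (f n tc) \<le> 1" if tc_in: "tc \<in> S \<times> C" for n tc
  proof -
    obtain t c where tc: "tc = (t, c)" "t \<in> S" using tc_in by auto
    have "0 \<le> b t * norm c" using le[OF tc(2), of n c] by linarith
    then show ?thesis
      using le[OF tc(2), of n c] by (auto simp: f_def tc divide_le_eq_1)
  qed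
  then obtain k where k: "strict_mono (k :: nat \<Rightarrow> nat)"
    and lim: "\<And>tc. tc \<in> S \<times> C \<Longrightarrow> \<exists>l. (\<lambda>n. f (k n) tc) \<longlonglongrightarrow> l"
    using function_convergent_subsequence[of "S \<times> C" f 1] S C(1)
    by (metis countable_SIGMA countable_finite)
  have "convergent (\<lambda>n. X (k n) t)" if t: "t \<in> S" for t
  proof -
    have "convergent (\<lambda>n. X (k n) t \<bullet> c)" if c: "c \<in> C" for c
    proof -
      obtain l where l: "(\<lambda>n. f (k n) (t, c)) \<longlonglongrightarrow> l" using lim[of "(t, c)"] t c by auto
      have "X n t \<bullet> c = f n (t, c) * (b t * norm c)" for n
        using le[OF t, of n c] by (auto simp: f_def)
      then show ?thesis
        using tendsto_mult_right[OF l, of "b t * norm c"] by (auto simp: convergent_def)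
    qed
    then obtain l where "\<And>c. c \<in> C \<Longrightarrow> (\<lambda>n. X (k n) t \<bullet> c) \<longlonglongrightarrow> l c"
      unfolding convergent_def by metis
    then have "(\<lambda>n. \<Sum>c\<in>C. (1 / (c \<bullet> c)) *\<^sub>R (X (k n) t \<bullet> c) *\<^sub>R c) 
        \<longlonglongrightarrow> (\<Sum>c\<in>C. (1 / (c \<bullet> c)) *\<^sub>R l c *\<^sub>R c)"
      by (intro tendsto_intros) auto
    then show ?thesis
      using orthogonal_expansion[OF C] by (auto simp: convergent_def)
  qed
  with k show ?thesis by (rule that)
qed

section \<open>The explicit Euler scheme\<close>

definition euler :: "('a::real_normed_vector \<Rightarrow> 'a) \<Rightarrow> real \<Rightarrow> 'a \<Rightarrow> nat \<Rightarrow> 'a" where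
  "euler F h x0 k = ((\<lambda>x. x + h *\<^sub>R F x) ^^ k) x0"

lemma euler_0 [simp]: "euler F h x0 0 = x0"
  and euler_Suc: "euler F h x0 (Suc k) = euler F h x0 k + h *\<^sub>R F (euler F h x0 k)"
  by (simp_all add: euler_def)

text \<open>
  A discrete mean value inequality: a trajectory that only sees slopes near \<open>v\<close> moves nearly like
  a line of slope \<open>v\<close>. With \<open>v = 0\<close> it gives the Lipschitz bound of the schemes, with \<open>v\<close> the slope
  at a limit point it gives the differential equation.
\<close>
lemma euler_increment:
  assumes "j \<le> k" "h \<ge> 0"
    and "\<And>i. i \<in> {j..<k} \<Longrightarrow> norm (F (euler F h x0 i) - v) \<le> e"
  shows "norm (euler F h x0 k - euler F h x0 j - (h * real k - h * real j) *\<^sub>R v)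
     \<le> e * (h * real k - h * real j)"
  using assms(1,3)
proof (induction k rule: dec_induct)
  case base
  then show ?case by simp
next
  case (step i)
  let ?E = "euler F h x0"
  have "?E (Suc i) - ?E j - (h * real (Suc i) - h * real j) *\<^sub>R v
      = (?E i - ?E j - (h * real i - h * real j) *\<^sub>R v) + h *\<^sub>R (F (?E i) - v)"
    by (simp add: euler_Suc algebra_simps)
  also have "norm \<dots> \<le> e * (h * real i - h * real j) + h * e"
    using step assms(2)
    by (intro norm_triangle_mono) (auto intro!: mult_left_mono)
  finally show ?case by (simp add: algebra_simps)
qed

text \<open>
  A discrete Gronwall inequality: each step multiplies \<open>1 + norm x\<close> by at most
  \<open>1 + K * h \<le> exp (K * h)\<close>. The bound depends on the elapsed time \<open>h * k\<close> only, not on the step size.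
\<close>
lemma euler_growth:
  fixes F :: "'a::real_normed_vector \<Rightarrow> 'a"
  assumes growth: "\<And>x. norm (F x) \<le> K * (1 + norm x)" and h: "h \<ge> 0"
  shows "1 + norm (euler F h x0 k) \<le> (1 + norm x0) * exp (K * (h * real k))"
proof (induction k)
  case (Suc k)
  let ?E = "euler F h x0 k"
  have "1 + norm (euler F h x0 (Suc k)) \<le> 1 + norm ?E + h * norm (F ?E)"
    using norm_triangle_ineq[of ?E "h *\<^sub>R F ?E"] h by (simp add: euler_Suc)
  also have "\<dots> \<le> 1 + norm ?E + h * (K * (1 + norm ?E))"
    using growth h by (intro add_left_mono mult_left_mono)
  also have "\<dots> = (1 + K * h) * (1 + norm ?E)"
    by (simp add: algebra_simps)
  also have "\<dots> \<le> exp (K * h) * ((1 + norm x0) * exp (K * (h * real k)))"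
    by (intro mult_mono Suc exp_ge_add_one_self) auto
  also have "\<dots> = (1 + norm x0) * exp (K * (h * real (Suc k)))"
    by (simp add: algebra_simps exp_add)
  finally show ?case .
qed simp

lemma euler_lipschitz:
  fixes F :: "'a::real_normed_vector \<Rightarrow> 'a"
  assumes growth: "\<And>x. norm (F x) \<le> K * (1 + norm x)" and h: "h \<ge> 0" and K: "K \<ge> 0"
    and T: "h * real j \<le> T" "h * real k \<le> T"
  shows "norm (euler F h x0 k - euler F h x0 j)
    \<le> K * (1 + norm x0) * exp (K * T) * \<bar>h * real k - h * real j\<bar>"
  using T
proof (induction j k rule: linorder_wlog)
  case (le j k)
  let ?M = "K * (1 + norm x0) * exp (K * T)"
  have "norm (F (euler F h x0 i) - 0) \<le> ?M" if "i \<in> {j..<k}" for i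
  proof -
    have "h * real i \<le> h * real k" using that h by (intro mult_left_mono) auto
    then have "h * real i \<le> T" using le by linarith
    have "norm (F (euler F h x0 i)) \<le> K * (1 + norm (euler F h x0 i))"
      by (rule growth)
    also have "\<dots> \<le> K * ((1 + norm x0) * exp (K * (h * real i)))"
      by (intro mult_left_mono euler_growth growth h K)
    also have "\<dots> \<le> K * ((1 + norm x0) * exp (K * T))"
      using \<open>h * real i \<le> T\<close> K by (intro mult_left_mono) (auto intro: mult_left_mono)
    finally show ?thesis by (simp add: mult.assoc)
  qed
  from euler_increment[where F = F and v = 0, OF le(1) h this]
  have "norm (euler F h x0 k - euler F h x0 j) \<le> ?M * (h * real k - h * real j)"
    by simp
  moreover have "h * real j \<le> h * real k" using le(1) h by (intro mult_left_mono) auto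
  ultimately show ?case by simp
next
  case (sym j k)
  then show ?case by (simp add: norm_minus_commute abs_minus_commute)
qed

section \<open>Peano's theorem with linear growth\<close>

text \<open>
  Linear growth excludes blow-up in finite time, which is why the solution exists on all of
  \<open>{0..}\<close>. The Euler schemes are defined on the whole half line from the start, so no local
  solutions have to be glued together.
\<close>
lemma peano_linear_growth:
  fixes F :: "'a::{real_inner, complete_space} \<Rightarrow> 'a"
  assumes fin: "finite B" "span B = (UNIV :: 'a set)"
    and cont: "continuous_on UNIV F"
    and growth: "\<And>x. norm (F x) \<le> K * (1 + norm x)"
  obtains x :: "real \<Rightarrow> 'a" where "x 0 = x0"
    "\<And>t. t \<ge> 0 \<Longrightarrow> (x has_vector_derivative F (x t)) (at t within {0..})"
proof -
  have K: "K \<ge> 0" using order_trans[OF norm_ge_zero growth[of 0]] by simp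
  define h where "h = (\<lambda>n. 1 / real (Suc n))"
  define p where "p = (\<lambda>n t. nat \<lfloor>t / h n\<rfloor>)"
  define X where "X = (\<lambda>n t. euler F (h n) x0 (p n t))"
  \<comment> \<open>The summand \<open>1\<close> makes the Lipschitz constant positive, so that one may divide by it.\<close>
  define M where "M = (\<lambda>T. K * (1 + norm x0) * exp (K * T) + 1)"
  have M: "M T > 0" for T using K by (simp add: M_def add_nonneg_pos)
  have h: "h n > 0" for n by (simp add: h_def)
  have grid: "h n * real (p n t) \<le> t" "t < h n * real (p n t) + h n" if "t \<ge> 0" for n t
  proof -
    have *: "real (p n t) = of_int \<lfloor>t / h n\<rfloor>" using that h[of n] by (simp add: p_def)
    have "of_int \<lfloor>t / h n\<rfloor> \<le> t / h n" "t / h n < of_int \<lfloor>t / h n\<rfloor> + 1" by linarith+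
    then have "of_int \<lfloor>t / h n\<rfloor> * h n \<le> t" "t < (of_int \<lfloor>t / h n\<rfloor> + 1) * h n"
      using h[of n] by (simp_all only: pos_le_divide_eq pos_divide_less_eq)
    then show "h n * real (p n t) \<le> t" "t < h n * real (p n t) + h n"
      by (simp_all add: * algebra_simps)
  qed
  have lip: "norm (euler F (h n) x0 j - euler F (h n) x0 i) \<le> M T * \<bar>h n * real j - h n * real i\<bar>"
    if "h n * real i \<le> T" "h n * real j \<le> T" for n i j T
    using euler_lipschitz[OF growth less_imp_le[OF h] K that, of x0]
    by (simp add: M_def distrib_right)
  define R where "R = {r :: real. r \<in> \<rat> \<and> 0 \<le> r}"
  have "norm (X n t) \<le> (1 + norm x0) * exp (K * t)" if "t \<in> R" for n t
  proof -
    have "1 + norm (X n t) \<le> (1 + norm x0) * exp (K * (h n * real (p n t)))"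
      unfolding X_def by (rule euler_growth[OF growth less_imp_le[OF h]])
    also have "\<dots> \<le> (1 + norm x0) * exp (K * t)"
      using grid(1)[of t n] that K by (intro mult_left_mono) (auto simp: R_def intro: mult_left_mono)
    finally show ?thesis by simp
  qed
  moreover have "countable R"
    unfolding R_def by (rule countable_subset[OF _ countable_rat]) auto
  ultimately obtain k where k: "strict_mono (k :: nat \<Rightarrow> nat)"
    and kR: "\<And>t. t \<in> R \<Longrightarrow> convergent (\<lambda>n. X (k n) t)"
    using pointwise_convergent_subsequence[OF fin, of R X] by metis
  have hk: "(\<lambda>n. h (k n)) \<longlonglongrightarrow> 0"
    using LIMSEQ_subseq_LIMSEQ[OF LIMSEQ_inverse_real_of_nat k]
    by (simp add: h_def o_def inverse_eq_divide)
  have h_small: "\<forall>\<^sub>F n in sequentially. h (k n) < d" if "d > 0" for d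
    by (rule order_tendstoD(2)[OF hk that])
  \<comment> \<open>Compare \<open>X n t\<close> with \<open>X n r\<close> at a nearby rational time \<open>r\<close>. The difference of the grid points
    is at most \<open>r - t\<close> plus one step, hence less than \<open>2 * d\<close>; the factor \<open>8\<close> turns this into \<open>e / 4\<close>.\<close>
  have conv: "convergent (\<lambda>n. X (k n) t)" if t: "t \<ge> 0" for t
  proof (rule Cauchy_convergent, rule metric_CauchyI)
    fix e :: real assume e: "e > 0"
    define d where "d = e / (8 * M (t + 1))"
    have d: "d > 0" "M (t + 1) * d = e / 8" using e M[of "t + 1"] by (auto simp: d_def)
    obtain r where r: "r \<in> \<rat>" "t < r" "r < t + min 1 d"
      using Rats_dense_in_real[of t "t + min 1 d"] d by auto
    have close: "norm (X n r - X n t) < e / 4" if "h n < d" for n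
    proof -
      have "\<bar>h n * real (p n r) - h n * real (p n t)\<bar> < 2 * d"
        using grid[of t n] grid[of r n] t r that by (simp add: abs_less_iff) 
      then have "M (t + 1) * \<bar>h n * real (p n r) - h n * real (p n t)\<bar> < M (t + 1) * (2 * d)"
        by (rule mult_strict_left_mono[OF _ M])
      moreover have "norm (X n r - X n t) \<le> M (t + 1) * \<bar>h n * real (p n r) - h n * real (p n t)\<bar>"
        unfolding X_def by (rule lip) (use grid(1)[of t n] grid(1)[of r n] t r in auto)
      ultimately show ?thesis using d(2) by linarith
    qed
    obtain N1 where N1: "\<And>n. n \<ge> N1 \<Longrightarrow> h (k n) < d"
      using h_small[OF d(1)] unfolding eventually_sequentially by blast
    have "Cauchy (\<lambda>n. X (k n) r)"
      using kR[of r] r t by (auto simp: R_def intro: convergent_Cauchy)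
    then obtain N2 where N2: "\<And>n m. n \<ge> N2 \<Longrightarrow> m \<ge> N2 \<Longrightarrow> dist (X (k n) r) (X (k m) r) < e / 4"
      using metric_CauchyD[of _ "e / 4"] e by (metis divide_pos_pos zero_less_numeral)
    show "\<exists>N. \<forall>m\<ge>N. \<forall>n\<ge>N. dist (X (k m) t) (X (k n) t) < e"
    proof (intro exI allI impI)
      fix m n assume mn: "m \<ge> max N1 N2" "n \<ge> max N1 N2"
      have "dist (X (k m) t) (X (k n) t) \<le> dist (X (k m) r) (X (k m) t)
          + dist (X (k m) r) (X (k n) r) + dist (X (k n) r) (X (k n) t)"
        by (metis (no_types, lifting) add.commute dist_commute dist_triangle dist_triangle_le
            add_left_mono order_trans)
      also have "\<dots> < e / 4 + e / 4 + e / 4"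
        using close[OF N1, of m] close[OF N1, of n] N2[of m n] mn by (simp add: dist_norm)
      finally show "dist (X (k m) t) (X (k n) t) < e" using e by simp
    qed
  qed
  define x where "x = (\<lambda>t. lim (\<lambda>n. X (k n) t))"
  have x: "(\<lambda>n. X (k n) t) \<longlonglongrightarrow> x t" if "t \<ge> 0" for t
    using conv[OF that] by (simp add: x_def convergent_LIMSEQ_iff)
  have grid_lim: "(\<lambda>n. h (k n) * real (p (k n) t)) \<longlonglongrightarrow> t" if t: "t \<ge> 0" for t
  proof (rule tendsto_sandwich[OF _ _ _ tendsto_const])
    show "(\<lambda>n. t - h (k n)) \<longlonglongrightarrow> t"
      using tendsto_diff[OF tendsto_const hk, of t] by simp
  qed (use grid[OF t] in \<open>auto simp: diff_le_eq less_imp_le intro!: always_eventually\<close>)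
  \<comment> \<open>Two arbitrary times \<open>a \<le> b\<close> near \<open>s\<close> are compared, rather than \<open>s\<close> and one other time: the cases
    \<open>a = s\<close> and \<open>b = s\<close> give the right and the left derivative at once.\<close>
  have local: "\<exists>d>0. \<forall>a b. 0 \<le> a \<longrightarrow> a \<le> b \<longrightarrow> \<bar>a - s\<bar> < d \<longrightarrow> \<bar>b - s\<bar> < d \<longrightarrow>
      norm (x b - x a - (b - a) *\<^sub>R F (x s)) \<le> e * (b - a)" if s: "s \<ge> 0" and e: "e > 0" for s e
  proof -
    have "isCont F (x s)" using cont by (simp add: continuous_on_eq_continuous_at)
    then obtain c where c: "c > 0" "\<And>y. dist y (x s) < c \<Longrightarrow> dist (F y) (F (x s)) < e"
      using e by (metis continuous_at_eps_delta)
    \<comment> \<open>Grid points between \<open>a\<close> and \<open>b\<close> are within \<open>2 * d\<close> of the grid point of \<open>s\<close>, so the scheme moves by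
      less than \<open>c / 2\<close> between them, and is within \<open>c / 4\<close> of \<open>x s\<close> there. The bound \<open>d \<le> 1\<close> keeps all
      times below \<open>s + 1\<close>.\<close>
    define d where "d = min 1 (c / (4 * M (s + 1)))"
    have d: "d > 0" "d \<le> 1" using c M[of "s + 1"] by (auto simp: d_def)
    have Md: "M (s + 1) * d \<le> c / 4"
      using mult_left_mono[of d "c / (4 * M (s + 1))" "M (s + 1)"] M[of "s + 1"]
      by (simp add: d_def)
    have "norm (x b - x a - (b - a) *\<^sub>R F (x s)) \<le> e * (b - a)"
      if ab: "0 \<le> a" "a \<le> b" "\<bar>a - s\<bar> < d" "\<bar>b - s\<bar> < d" for a b
    proof (rule LIMSEQ_le)
      let ?D = "\<lambda>n. h (k n) * real (p (k n) b) - h (k n) * real (p (k n) a)"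
      have b: "0 \<le> b" using ab by linarith
      have D: "?D \<longlonglongrightarrow> b - a"
        by (intro tendsto_diff grid_lim ab b)
      show "(\<lambda>n. norm (X (k n) b - X (k n) a - ?D n *\<^sub>R F (x s)))
          \<longlonglongrightarrow> norm (x b - x a - (b - a) *\<^sub>R F (x s))"
        by (intro tendsto_intros x ab b D)
      show "(\<lambda>n. e * ?D n) \<longlonglongrightarrow> e * (b - a)"
        by (intro tendsto_intros D)
      have "\<forall>\<^sub>F n in sequentially. dist (X (k n) s) (x s) < c / 4"
        using tendstoD[OF x[OF s], of "c / 4"] c by auto
      then have "\<forall>\<^sub>F n in sequentially. norm (X (k n) b - X (k n) a - ?D n *\<^sub>R F (x s)) \<le> e * ?D n"
        using h_small[OF d(1)]
      proof eventually_elim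
        case (elim n)
        let ?E = "euler F (h (k n)) x0"
        show ?case unfolding X_def
        proof (rule euler_increment)
          show "p (k n) a \<le> p (k n) b"
            unfolding p_def using ab h[of "k n"]
            by (intro nat_mono floor_mono divide_right_mono) auto
          show "h (k n) \<ge> 0" using h[of "k n"] by simp
          fix i assume i: "i \<in> {p (k n) a..<p (k n) b}"
          have "h (k n) * real (p (k n) a) \<le> h (k n) * real i"
            "h (k n) * real i \<le> h (k n) * real (p (k n) b)"
            using i h[of "k n"] by (auto intro!: mult_left_mono)
          then have i': "a - h (k n) < h (k n) * real i" "h (k n) * real i \<le> b"
            using grid[OF ab(1), of "k n"] grid[OF b, of "k n"] by linarith+
          have "\<bar>h (k n) * real i - h (k n) * real (p (k n) s)\<bar> < 2 * d"
            using i' grid[OF s, of "k n"] ab elim(2) by linarith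
          then have "M (s + 1) * \<bar>h (k n) * real i - h (k n) * real (p (k n) s)\<bar> < M (s + 1) * (2 * d)"
            by (rule mult_strict_left_mono[OF _ M])
          moreover have "norm (?E i - X (k n) s)
              \<le> M (s + 1) * \<bar>h (k n) * real i - h (k n) * real (p (k n) s)\<bar>"
            unfolding X_def
            by (rule lip) (use i' grid(1)[OF s, of "k n"] ab d(2) in linarith)+
          ultimately have "dist (?E i) (X (k n) s) < c / 2"
            using Md by (simp add: dist_norm)
          then have "dist (?E i) (x s) < c"
            using dist_triangle[of "?E i" "x s" "X (k n) s"] elim(1) c(1) by linarith
          from c(2)[OF this] show "norm (F (?E i) - F (x s)) \<le> e"
            by (simp add: dist_norm)
        qed
      qed
      then show "\<exists>N. \<forall>n\<ge>N. norm (X (k n) b - X (k n) a - ?D n *\<^sub>R F (x s)) \<le> e * ?D n"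
        by (simp add: eventually_sequentially)
    qed
    with d(1) show ?thesis by blast
  qed
  have "(x has_vector_derivative F (x s)) (at s within {0..})" if s: "s \<ge> 0" for s
    unfolding has_vector_derivative_def has_derivative_within_alt
  proof (intro conjI allI impI bounded_linear_scaleR_left)
    fix e :: real assume "e > 0"
    from local[OF s this] obtain d where d: "d > 0"
      and loc: "\<And>a b. 0 \<le> a \<Longrightarrow> a \<le> b \<Longrightarrow> \<bar>a - s\<bar> < d \<Longrightarrow> \<bar>b - s\<bar> < d \<Longrightarrow>
        norm (x b - x a - (b - a) *\<^sub>R F (x s)) \<le> e * (b - a)" by blast
    have "norm (x t - x s - (t - s) *\<^sub>R F (x s)) \<le> e * norm (t - s)"
      if t: "0 \<le> t" "norm (t - s) < d" for t
    proof (cases "s \<le> t")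
      case True
      then show ?thesis using loc[of s t] s t d by simp
    next
      case False
      have "x t - x s - (t - s) *\<^sub>R F (x s) = - (x s - x t - (s - t) *\<^sub>R F (x s))"
        by (simp add: algebra_simps)
      then show ?thesis
        using loc[of t s] s t d False by (simp only: norm_minus_cancel) simp
    qed
    with d show "\<exists>d>0. \<forall>t\<in>{0..}. norm (t - s) < d \<longrightarrow>
        norm (x t - x s - (t - s) *\<^sub>R F (x s)) \<le> e * norm (t - s)" by auto
  qed
  moreover have "x 0 = x0"
    using x[of 0] by (simp add: X_def p_def LIMSEQ_const_iff)
  ultimately show ?thesis by (rule that[rotated])
qed

section \<open>The inertial system\<close>

lemma finite_span_prod:
  fixes B :: "'a::real_vector set"
  assumes "finite B" "span B = UNIV"
  shows "\<exists>C :: ('a \<times> 'a) set. finite C \<and> span C = UNIV"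
proof -
  let ?C = "(\<lambda>b. (b, 0)) ` B \<union> (\<lambda>b. (0, b)) ` B"
  have l: "linear (\<lambda>b :: 'a. (b, 0 :: 'a))" "linear (\<lambda>b :: 'a. (0 :: 'a, b))"
    by (auto intro!: linearI)
  have "(u, v) \<in> span ?C" for u v
  proof -
    have "(u, 0 :: 'a) \<in> span ((\<lambda>b. (b, 0)) ` B)" "(0 :: 'a, v) \<in> span ((\<lambda>b. (0, b)) ` B)"
      unfolding linear_span_image[OF l(1)] linear_span_image[OF l(2)] assms(2) by auto
    then have "(u, 0) \<in> span ?C" "(0, v) \<in> span ?C"
      by (meson Un_upper1 Un_upper2 span_mono subsetD)+
    from span_add[OF this] show ?thesis by simp
  qed
  then have "span ?C = UNIV" by auto
  moreover have "finite ?C" using assms(1) by simp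
  ultimately show ?thesis by (intro exI[of _ ?C]) simp
qed

theorem theorem3p5:
  fixes f :: "nat \<Rightarrow> 'a::{real_inner, complete_space} \<Rightarrow> real"
    and q :: nat and m \<gamma> t0 :: real and u0 v0 :: 'a
  assumes "q \<ge> 1" and "m > 0" and "\<gamma> > 0"
    and C1: "\<And>i. i \<in> {1..q} \<Longrightarrow> continuously_differentiable (f i)"
    and lipschitz_bounded:
      "\<And>i S. i \<in> {1..q} \<Longrightarrow> bounded S \<Longrightarrow> \<exists>L. L-lipschitz_on S (gradient (f i))"
    and finite_dim: "\<exists>B :: 'a set. finite B \<and> span B = UNIV"
    and lipschitz_global: "\<And>i. i \<in> {1..q} \<Longrightarrow> \<exists>L. L-lipschitz_on UNIV (gradient (f i))"
  shows "\<exists>u u' u'' :: real \<Rightarrow> 'a.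
           (\<forall>t\<in>{t0..}. (u has_vector_derivative u' t) (at t within {t0..})) \<and>
           (\<forall>t\<in>{t0..}. (u' has_vector_derivative u'' t) (at t within {t0..})) \<and>
           continuous_on {t0..} u'' \<and>
           (\<forall>t\<in>{t0..}. m *\<^sub>R u'' t = - \<gamma> *\<^sub>R u' t + steepest_descent q f (u t)) \<and>
           u t0 = u0 \<and> u' t0 = v0"
proof -
  let ?s = "steepest_descent q f"
  define F where "F = (\<lambda>z :: 'a \<times> 'a. (snd z, (1 / m) *\<^sub>R (- \<gamma> *\<^sub>R snd z + ?s (fst z))))"
  have cont_s: "continuous_on UNIV ?s"
    using lipschitz_global \<open>q \<ge> 1\<close>
    by (intro continuous_on_steepest_descent) (auto dest: lipschitz_on_continuous_on)
  have cont_F: "continuous_on UNIV F"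
    unfolding F_def
    by (intro continuous_intros continuous_on_compose2[OF cont_s]) auto
  obtain L where L: "L-lipschitz_on UNIV (gradient (f 1))"
    using lipschitz_global[of 1] \<open>q \<ge> 1\<close> by auto
  have "L \<ge> 0" using L by (rule lipschitz_on_nonneg)
  let ?G = "norm (gradient (f 1) 0)"
  have s_bound: "norm (?s u) \<le> (?G + L) * (1 + norm u)" for u
  proof -
    have "norm (?s u) \<le> norm (gradient (f 1) u)"
      using \<open>q \<ge> 1\<close> by (intro minus_steepest_descent_min_norm(2) gradient_in_grad_hull) auto
    also have "\<dots> \<le> ?G + norm (gradient (f 1) u - gradient (f 1) 0)"
      using norm_triangle_ineq2[of "gradient (f 1) u" "gradient (f 1) 0"] by linarith
    also have "\<dots> \<le> ?G + L * norm u"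
      using lipschitz_onD[OF L, of u 0] by (simp add: dist_norm)
    also have "\<dots> \<le> (?G + L) * (1 + norm u)"
      using \<open>L \<ge> 0\<close> by (simp add: algebra_simps)
    finally show ?thesis .
  qed
  have growth: "norm (F z) \<le> (1 + (1 / m) * (\<gamma> + (?G + L))) * (1 + norm z)" for z
  proof -
    have n: "norm (fst z) \<le> norm z" "norm (snd z) \<le> norm z"
      using norm_fst_le[of "fst z" "snd z"] norm_snd_le[of "snd z" "fst z"] by simp_all
    have a: "norm (- \<gamma> *\<^sub>R snd z) \<le> \<gamma> * (1 + norm z)"
      using \<open>\<gamma> > 0\<close> n by (auto intro!: mult_left_mono)
    have b: "norm (?s (fst z)) \<le> (?G + L) * (1 + norm z)"
      using \<open>L \<ge> 0\<close> n by (intro order_trans[OF s_bound] mult_left_mono) auto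
    have "norm (F z) \<le> norm (snd z) + norm ((1 / m) *\<^sub>R (- \<gamma> *\<^sub>R snd z + ?s (fst z)))"
      unfolding F_def by (rule norm_Pair_le)
    also have "\<dots> \<le> norm z + (1 / m) * (\<gamma> * (1 + norm z) + (?G + L) * (1 + norm z))"
      using \<open>m > 0\<close> n norm_triangle_mono[OF a b]
      by (auto intro!: add_mono divide_right_mono)
    also have "\<dots> \<le> (1 + (1 / m) * (\<gamma> + (?G + L))) * (1 + norm z)"
      by (simp add: distrib_left distrib_right)
    finally show ?thesis .
  qed
  obtain C :: "('a \<times> 'a) set" where C: "finite C" "span C = UNIV"
    using finite_dim finite_span_prod by metis
  obtain z where z0: "z 0 = (u0, v0)"
    and z: "\<And>t. t \<ge> 0 \<Longrightarrow> (z has_vector_derivative F (z t)) (at t within {0..})"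
    using peano_linear_growth[OF C cont_F growth] by metis
  \<comment> \<open>The system is autonomous, so a solution starting at time \<open>0\<close> may be shifted to \<open>t0\<close>.\<close>
  define w where "w = (\<lambda>t. z (t - t0))"
  have w: "(w has_vector_derivative F (w t)) (at t within {t0..})" if "t \<in> {t0..}" for t
  proof -
    have "((\<lambda>t. t - t0) has_vector_derivative 1) (at t within {t0..})"
      by (auto intro!: derivative_eq_intros)
    moreover have "(z has_vector_derivative F (w t)) (at (t - t0) within (\<lambda>t. t - t0) ` {t0..})"
      unfolding w_def
      by (rule has_vector_derivative_within_subset[OF z]) (use that in auto)
    ultimately have "(z \<circ> (\<lambda>t. t - t0) has_vector_derivative 1 *\<^sub>R F (w t)) (at t within {t0..})"
      by (rule vector_diff_chain_within)
    then show ?thesis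
      by (simp add: w_def comp_def)
  qed
  have cont_w: "continuous_on {t0..} w"
    using w by (rule continuous_on_vector_derivative)
  have "((\<lambda>t. fst (w t)) has_vector_derivative snd (w t)) (at t within {t0..})"
    and "((\<lambda>t. snd (w t)) has_vector_derivative snd (F (w t))) (at t within {t0..})"
    if "t \<in> {t0..}" for t
    using bounded_linear.has_vector_derivative[OF bounded_linear_fst w[OF that]]
      bounded_linear.has_vector_derivative[OF bounded_linear_snd w[OF that]]
    by (simp_all add: F_def)
  moreover have "continuous_on {t0..} (\<lambda>t. snd (F (w t)))"
    by (intro continuous_on_snd continuous_on_compose2[OF cont_F cont_w]) auto
  moreover have "m *\<^sub>R snd (F (w t)) = - \<gamma> *\<^sub>R snd (w t) + ?s (fst (w t))" for t
    using \<open>m > 0\<close> by (simp add: F_def)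
  moreover have "w t0 = (u0, v0)"
    using z0 by (simp add: w_def)
  ultimately show ?thesis
    by (intro exI[of _ "\<lambda>t. fst (w t)"] exI[of _ "\<lambda>t. snd (w t)"] exI[of _ "\<lambda>t. snd (F (w t))"])
       simp
qed

end
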